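(* Let $r\ge1$ be an integer, $\lambda\in\mathbb{C}$ with $\Re(\lambda)\le0$, and $y_0\in\mathbb{C}\setminus\{0\}$. Let $y(t)$ be the solution of $y'=\lambda y$, $y(t_0)=y_0$, on $[t_0,+\infty)$. For a stepsize $h>0$, let $t_i=t_0+ih$ and let $\omega_i=\omega(t_i)$, $i=0,1,2,\dots$, where $\omega$ is the continuous piecewise polynomial with $\omega(t_0)=y_0$ that on each interval $[t_{i-1},t_i]$, $i\ge1$, is a polynomial of degree at most $r$ satisfying $$\omega'(t_{i-1}+ch)=\lambda\sum_{j=0}^{r-1}\hat P_j(c)\int_0^1\hat P_j(\tau)\,\omega(t_{i-1}+\tau h)\,\mathrm{d}\tau,\qquad c\in[0,1].$$ Then, for any choice of the stepsize $h>0$, $y(t)$ and its discrete approximation $\{\omega_i\}$ have the same stability properties, namely: $\omega_i\to0$ as $i\to\infty$ if and only if $\Re(\lambda)<0$ (equivalently, if and only if $y(t)\to0$ as $t\to+\infty$), and $\{\omega_i\}$ remains bounded (as does $y(t)$) whenever $\Re(\lambda)=0$.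
   Context: $\{\hat P_j\}_{j\ge 0}$ are the shifted Legendre polynomials on $[0,1]$, scaled to be orthonormal: $\deg \hat P_j=j$ and $\int_0^1 \hat P_i(x)\hat P_j(x)\,\mathrm{d}x=\delta_{ij}$ for all $i,j\ge 0$. *)

theory Defs
  imports "HOL-Analysis.Analysis" "HOL-Computational_Algebra.Polynomial"
begin

text \<open>
  These two conditions determine each polynomial up to its sign. Below, the polynomials occur
  only in products of two with the same index, so the choice of sign does not matter.
\<close>
definition orthonormal_shifted_Legendre :: "(nat \<Rightarrow> real poly) \<Rightarrow> bool" where
  "orthonormal_shifted_Legendre P \<longleftrightarrow>
     (\<forall>j. degree (P j) = j) \<and>
     (\<forall>i j. integral {0..1} (\<lambda>x. poly (P i) x * poly (P j) x) = (if i = j then 1 else 0))"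

definition grid :: "real \<Rightarrow> real \<Rightarrow> nat \<Rightarrow> real" where
  "grid t0 h i = t0 + real i * h"

text \<open>
  The subinterval with index \<open>i\<close> here is \<open>[t\<^sub>i, t\<^sub>i\<^sub>+\<^sub>1]\<close>, with \<open>i \<ge> 0\<close>. The derivative is taken
  within the subinterval, hence is one-sided at its endpoints: \<open>\<omega>\<close> is in general not
  differentiable at the grid points.
\<close>
definition piecewise_poly_approx ::
  "(nat \<Rightarrow> real poly) \<Rightarrow> nat \<Rightarrow> complex \<Rightarrow> real \<Rightarrow> complex \<Rightarrow> real \<Rightarrow> (real \<Rightarrow> complex) \<Rightarrow> bool" where
  "piecewise_poly_approx P r lam t0 y0 h \<omega> \<longleftrightarrow>
     \<omega> t0 = y0 \<and>
     continuous_on {t0..} \<omega> \<and>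
     (\<forall>i. \<exists>p :: complex poly. degree p \<le> r \<and>
        (\<forall>t\<in>{grid t0 h i..grid t0 h (Suc i)}. \<omega> t = poly p (complex_of_real t))) \<and>
     (\<forall>i. \<forall>c\<in>{0..1}.
        (\<omega> has_vector_derivative
          lam * (\<Sum>j<r. complex_of_real (poly (P j) c) *
            integral {0..1} (\<lambda>\<tau>. complex_of_real (poly (P j) \<tau>) * \<omega> (grid t0 h i + \<tau> * h))))
        (at (grid t0 h i + c * h) within {grid t0 h i..grid t0 h (Suc i)}))"

end

theory Submission imports Defs begin

text \<open>
  Rescale one subinterval to \<open>[0,1]\<close> by \<open>u c = \<omega> (t\<^sub>i + c * h)\<close>, put \<open>\<mu> = h * \<lambda>\<close>, and let
  \<open>m\<^sub>j\<close> be the integral of \<open>P\<^sub>j * u\<close> over \<open>[0,1]\<close>. The scheme says that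
  \<open>u' = \<mu> * (\<Sum>j<r. m\<^sub>j * P\<^sub>j)\<close>. Multiplying by the conjugate of \<open>u\<close>, integrating and taking twice
  the real part, the same numbers \<open>m\<^sub>j\<close> reappear and give the exact energy balance
  \<open>\<bar>u 1\<bar>\<^sup>2 - \<bar>u 0\<bar>\<^sup>2 = 2 * Re \<mu> * (\<Sum>j<r. \<bar>m\<^sub>j\<bar>\<^sup>2)\<close> (lemma \<open>energy_balance\<close>).

  For \<open>Re \<lambda> = 0\<close> the modulus of \<open>\<omega>\<^sub>i\<close> is therefore constant, so the sequence is bounded and stays
  away from \<open>0\<close>. For \<open>Re \<lambda> < 0\<close> the modulus strictly decreases unless every \<open>m\<^sub>j\<close> vanishes; but
  then \<open>u\<close> is constant, and \<open>m\<^sub>0 = 0\<close> with \<open>P\<^sub>0\<close> a nonzero constant forces \<open>u = 0\<close>. Hence a step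
  started at \<open>0\<close> ends at \<open>0\<close>, so by linearity all steps multiply their initial value by one common
  factor \<open>R\<close>, and \<open>\<bar>R\<bar> < 1\<close> by the strict decrease of the first step. So \<open>\<omega>\<^sub>i = R ^ i * y\<^sub>0\<close> tends
  to \<open>0\<close>.

  The exact solution is \<open>y t = y\<^sub>0 * exp (\<lambda> * (t - t\<^sub>0))\<close>, whose modulus shows the same two cases.
\<close>

section \<open>One step of the method on the unit interval\<close>

definition moment :: "real poly \<Rightarrow> (real \<Rightarrow> complex) \<Rightarrow> complex" where
  "moment p u = integral {0..1} (\<lambda>\<tau>. complex_of_real (poly p \<tau>) * u \<tau>)"

definition unit_step :: "(nat \<Rightarrow> real poly) \<Rightarrow> nat \<Rightarrow> complex \<Rightarrow> (real \<Rightarrow> complex) \<Rightarrow> bool" where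
  "unit_step P r \<mu> u \<longleftrightarrow>
     (\<forall>c\<in>{0..1}. (u has_vector_derivative
        \<mu> * (\<Sum>j<r. complex_of_real (poly (P j) c) * moment (P j) u)) (at c within {0..1}))"

lemma unit_step_continuous: "unit_step P r \<mu> u \<Longrightarrow> continuous_on {0..1} u"
  unfolding unit_step_def by (intro continuous_on_vector_derivative) blast

lemma has_integral_moment:
  assumes "continuous_on {0..1} u"
  shows "((\<lambda>\<tau>. complex_of_real (poly p \<tau>) * u \<tau>) has_integral moment p u) {0..1}"
  unfolding moment_def
  by (intro integrable_integral integrable_continuous_interval continuous_intros assms)

lemma moment_diff_scaled:
  assumes "continuous_on {0..1} u" "continuous_on {0..1} v"
  shows "moment p (\<lambda>c. v c - k * u c) = moment p v - k * moment p u"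
proof -
  have "((\<lambda>\<tau>. complex_of_real (poly p \<tau>) * v \<tau> - k * (complex_of_real (poly p \<tau>) * u \<tau>))
      has_integral moment p v - k * moment p u) {0..1}"
    by (intro has_integral_diff has_integral_mult_right has_integral_moment assms)
  then show ?thesis
    unfolding moment_def by (intro integral_unique) (simp add: algebra_simps)
qed

lemma unit_step_diff_scaled:
  assumes u: "unit_step P r \<mu> u" and v: "unit_step P r \<mu> v"
  shows "unit_step P r \<mu> (\<lambda>c. v c - k * u c)"
  unfolding unit_step_def
proof
  fix c :: real assume c: "c \<in> {0..1}"
  have "((\<lambda>c. v c - k * u c) has_vector_derivative
      \<mu> * (\<Sum>j<r. complex_of_real (poly (P j) c) * moment (P j) v)
      - k * (\<mu> * (\<Sum>j<r. complex_of_real (poly (P j) c) * moment (P j) u))) (at c within {0..1})"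
    using u v c unfolding unit_step_def
    by (intro has_vector_derivative_diff has_vector_derivative_mult_right) auto
  then show "((\<lambda>c. v c - k * u c) has_vector_derivative
      \<mu> * (\<Sum>j<r. complex_of_real (poly (P j) c) * moment (P j) (\<lambda>c. v c - k * u c)))
      (at c within {0..1})"
    by (simp add: moment_diff_scaled unit_step_continuous[OF u] unit_step_continuous[OF v]
        algebra_simps sum_subtractf sum_distrib_left)
qed

text \<open>
  The derivative of \<open>u * cnj u\<close> is a combination of the functions \<open>P\<^sub>j * u\<close> and their conjugates,
  with coefficients that contain the moments of \<open>u\<close>. Integrating it turns each of these functions
  into a moment again, which is what produces the squared moduli.
\<close>
lemma energy_balance:
  assumes u: "unit_step P r \<mu> u"
  shows "(cmod (u 1))\<^sup>2 - (cmod (u 0))\<^sup>2 = 2 * Re \<mu> * (\<Sum>j<r. (cmod (moment (P j) u))\<^sup>2)"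
proof -
  define m where "m j = moment (P j) u" for j
  define du where "du c = \<mu> * (\<Sum>j<r. complex_of_real (poly (P j) c) * m j)" for c
  have du: "(u has_vector_derivative du c) (at c within {0..1})" if "c \<in> {0..1}" for c
    using u that unfolding unit_step_def du_def m_def by blast
  have FTC: "((\<lambda>c. u c * cnj (du c) + du c * cnj (u c)) has_integral
      u 1 * cnj (u 1) - u 0 * cnj (u 0)) {0..1}"
    by (rule fundamental_theorem_of_calculus)
      (auto intro!: has_vector_derivative_mult has_vector_derivative_cnj du)
  have m: "((\<lambda>c. complex_of_real (poly (P j) c) * u c) has_integral m j) {0..1}" for j
    unfolding m_def using u by (intro has_integral_moment unit_step_continuous)
  have mc: "((\<lambda>c. complex_of_real (poly (P j) c) * cnj (u c)) has_integral cnj (m j)) {0..1}" for j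
    using has_integral_linear[OF m bounded_linear_cnj, of j] by (simp add: o_def)
  have moments: "((\<lambda>c. (\<Sum>j<r. (cnj \<mu> * cnj (m j)) * (complex_of_real (poly (P j) c) * u c))
        + (\<Sum>j<r. (\<mu> * m j) * (complex_of_real (poly (P j) c) * cnj (u c)))) has_integral
      (\<Sum>j<r. (cnj \<mu> * cnj (m j)) * m j) + (\<Sum>j<r. (\<mu> * m j) * cnj (m j))) {0..1}"
    by (intro has_integral_add has_integral_sum has_integral_mult_right m mc) auto
  have integrand: "(\<lambda>c. (\<Sum>j<r. (cnj \<mu> * cnj (m j)) * (complex_of_real (poly (P j) c) * u c))
        + (\<Sum>j<r. (\<mu> * m j) * (complex_of_real (poly (P j) c) * cnj (u c))))
      = (\<lambda>c. u c * cnj (du c) + du c * cnj (u c))"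
    unfolding du_def by (simp add: sum_distrib_left sum_distrib_right mult_ac)
  have "u 1 * cnj (u 1) - u 0 * cnj (u 0)
      = (\<Sum>j<r. (cnj \<mu> * cnj (m j)) * m j) + (\<Sum>j<r. (\<mu> * m j) * cnj (m j))"
    by (rule has_integral_unique[OF FTC moments[unfolded integrand]])
  also have "\<dots> = (cnj \<mu> + \<mu>) * (\<Sum>j<r. m j * cnj (m j))"
    unfolding sum_distrib_left sum.distrib[symmetric]
    by (intro sum.cong) (simp_all add: algebra_simps)
  also have "\<dots> = complex_of_real (2 * Re \<mu> * (\<Sum>j<r. (cmod (m j))\<^sup>2))"
    by (simp only: add.commute[of "cnj \<mu>"] complex_add_cnj complex_norm_square of_real_mult
        of_real_sum)
  finally have "complex_of_real ((cmod (u 1))\<^sup>2 - (cmod (u 0))\<^sup>2)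
      = complex_of_real (2 * Re \<mu> * (\<Sum>j<r. (cmod (m j))\<^sup>2))"
    by (simp only: of_real_diff complex_norm_square)
  then show ?thesis
    unfolding m_def of_real_eq_iff .
qed

lemma orthonormal_poly_0:
  assumes "orthonormal_shifted_Legendre P"
  obtains a where "P 0 = [:a:]" "a \<noteq> 0"
proof -
  from assms have deg: "degree (P 0) = 0"
    and int: "integral {0..1} (\<lambda>x. poly (P 0) x * poly (P 0) x) = 1"
    unfolding orthonormal_shifted_Legendre_def by auto
  from deg obtain a where "P 0 = [:a:]"
    by (rule degree_eq_zeroE)
  moreover from this int have "a \<noteq> 0" by auto
  ultimately show ?thesis by (rule that)
qed

text \<open>
  With \<open>Re \<mu> < 0\<close>, a modulus that does not decrease makes the right-hand side of the energy
  balance vanish, hence all moments, hence \<open>u'\<close>; the moment with respect to the nonzero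
  constant \<open>P\<^sub>0\<close> then identifies the constant \<open>u\<close> as \<open>0\<close>. The assumption \<open>r \<ge> 1\<close> is what puts \<open>P\<^sub>0\<close> among the moments.
\<close>
lemma unit_step_not_decreasing_imp_zero:
  assumes P: "orthonormal_shifted_Legendre P" and r: "r \<ge> 1" and mu: "Re \<mu> < 0"
    and u: "unit_step P r \<mu> u" and le: "cmod (u 0) \<le> cmod (u 1)"
    and c: "c \<in> {0..1}"
  shows "u c = 0"
proof -
  let ?S = "\<Sum>j<r. (cmod (moment (P j) u))\<^sup>2"
  have "0 \<le> 2 * Re \<mu> * ?S"
    using energy_balance[OF u] power_mono[OF le norm_ge_zero, of 2] by linarith
  then have "?S \<le> 0"
    using mu by (simp add: zero_le_mult_iff)
  then have "?S = 0"
    by (intro antisym sum_nonneg) auto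
  then have m0: "moment (P j) u = 0" if "j < r" for j
    using that by (simp add: sum_nonneg_eq_0_iff)
  have "(u has_vector_derivative 0) (at x within {0..1})" if "x \<in> {0..1}" for x
    using u that unfolding unit_step_def by (auto simp: m0)
  then obtain k where k: "\<And>x. x \<in> {0..1} \<Longrightarrow> u x = k"
    by (metis has_vector_derivative_zero_constant convex_real_interval(5))
  obtain a where a: "P 0 = [:a:]" "a \<noteq> 0"
    using orthonormal_poly_0[OF P] .
  have "moment (P 0) u = integral {0..1::real} (\<lambda>\<tau>. complex_of_real a * k)"
    unfolding moment_def by (intro integral_cong) (simp add: a k)
  then have "complex_of_real a * k = 0"
    using m0[of 0] r by simp
  then show ?thesis
    using a k[OF c] by simp
qed

section \<open>The grid values\<close>

text \<open>
  The left-hand sides are the rescaled function \<open>\<lambda>c. \<omega> (t\<^sub>i + c * h)\<close> at \<open>c = 0\<close> and \<open>c = 1\<close>, in the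
  form in which \<open>energy_balance\<close> produces them.
\<close>
lemma grid_step_endpoints:
  "\<omega> (grid t0 h i + 0 * h) = \<omega> (grid t0 h i)"
  "\<omega> (grid t0 h i + 1 * h) = \<omega> (grid t0 h (Suc i))"
  by (simp_all add: grid_def algebra_simps)

lemma piecewise_poly_approx_unit_step:
  assumes "piecewise_poly_approx P r lam t0 y0 h \<omega>" and h: "h > 0"
  shows "unit_step P r (of_real h * lam) (\<lambda>c. \<omega> (grid t0 h i + c * h))"
  unfolding unit_step_def
proof
  fix c :: real assume c: "c \<in> {0..1}"
  let ?g = "\<lambda>c. grid t0 h i + c * h"
  let ?S = "\<Sum>j<r. complex_of_real (poly (P j) c) * moment (P j) (\<lambda>c. \<omega> (?g c))"
  have img: "?g ` {0..1} \<subseteq> {grid t0 h i..grid t0 h (Suc i)}"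
    using h by (auto simp: grid_def distrib_right intro: mult_left_le_one_le)
  have "(\<omega> has_vector_derivative lam * ?S) (at (?g c) within {grid t0 h i..grid t0 h (Suc i)})"
    using assms(1) c unfolding piecewise_poly_approx_def moment_def by blast
  then have "(\<omega> has_vector_derivative lam * ?S) (at (?g c) within ?g ` {0..1})"
    by (rule has_vector_derivative_within_subset[OF _ img])
  moreover have "(?g has_vector_derivative h) (at c within {0..1})"
    by (auto intro!: derivative_eq_intros simp: has_real_derivative_iff_has_vector_derivative[symmetric])
  ultimately have "((\<omega> \<circ> ?g) has_vector_derivative h *\<^sub>R (lam * ?S)) (at c within {0..1})"
    by (intro vector_diff_chain_within)
  then show "((\<lambda>c. \<omega> (?g c)) has_vector_derivative of_real h * lam * ?S) (at c within {0..1})"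
    by (simp add: o_def scaleR_conv_of_real mult.assoc)
qed

lemma grid_values_norm_constant:
  assumes "piecewise_poly_approx P r lam t0 y0 h \<omega>" "h > 0" "Re lam = 0"
  shows "cmod (\<omega> (grid t0 h i)) = cmod y0"
proof (induction i)
  case 0
  show ?case using assms(1) by (simp add: grid_def piecewise_poly_approx_def)
next
  case (Suc i)
  have "(cmod (\<omega> (grid t0 h (Suc i))))\<^sup>2 = (cmod (\<omega> (grid t0 h i)))\<^sup>2"
    using energy_balance[OF piecewise_poly_approx_unit_step[OF assms(1,2), of i]] assms(3)
    unfolding grid_step_endpoints by simp
  with Suc show ?case by (simp add: power2_eq_iff_nonneg)
qed

text \<open>
  The difference of the step on the interval with index \<open>i\<close> and the multiple of the first step with
  the same initial value is again a step, started at \<open>0\<close>. It cannot decrease in modulus, so it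
  vanishes.
\<close>
lemma grid_values_geometric:
  assumes P: "orthonormal_shifted_Legendre P" and r: "r \<ge> 1" and lam: "Re lam < 0"
    and h: "h > 0" and w: "piecewise_poly_approx P r lam t0 y0 h \<omega>" and y0: "y0 \<noteq> 0"
  obtains R where "cmod R < 1" "\<And>i. \<omega> (grid t0 h i) = R ^ i * y0"
proof
  define R where "R = \<omega> (grid t0 h (Suc 0)) / y0"
  let ?u = "\<lambda>i c. \<omega> (grid t0 h i + c * h)"
  have mu: "Re (of_real h * lam) < 0"
    using h lam by (simp add: mult_pos_neg)
  have step: "unit_step P r (of_real h * lam) (?u i)" for i
    by (rule piecewise_poly_approx_unit_step[OF w h])
  have w0: "\<omega> (grid t0 h 0) = y0"
    using w by (simp add: grid_def piecewise_poly_approx_def)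
  have "\<not> cmod (?u 0 0) \<le> cmod (?u 0 1)"
    using unit_step_not_decreasing_imp_zero[OF P r mu step, of 0 0] w0 y0
    unfolding grid_step_endpoints by auto
  then have "cmod (\<omega> (grid t0 h (Suc 0))) < cmod y0"
    unfolding grid_step_endpoints w0 by simp
  then show "cmod R < 1"
    using y0 by (simp add: R_def norm_divide)
  have rec: "\<omega> (grid t0 h (Suc i)) = R * \<omega> (grid t0 h i)" for i
  proof -
    let ?k = "\<omega> (grid t0 h i) / y0"
    let ?v = "\<lambda>c. ?u i c - ?k * ?u 0 c"
    have "?v 0 = 0"
      unfolding grid_step_endpoints w0 using y0 by simp
    then have "?v 1 = 0"
      by (intro unit_step_not_decreasing_imp_zero[OF P r mu unit_step_diff_scaled[OF step step]])
        simp_all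
    then have "\<omega> (grid t0 h (Suc i)) = ?k * \<omega> (grid t0 h (Suc 0))"
      unfolding grid_step_endpoints by simp
    then show ?thesis by (simp add: R_def)
  qed
  show "\<omega> (grid t0 h i) = R ^ i * y0" for i
    by (induction i) (simp_all add: rec w0)
qed

lemma grid_values_tendsto_0_iff:
  assumes P: "orthonormal_shifted_Legendre P" and r: "r \<ge> 1" and lam: "Re lam \<le> 0"
    and h: "h > 0" and w: "piecewise_poly_approx P r lam t0 y0 h \<omega>" and y0: "y0 \<noteq> 0"
  shows "(\<lambda>i. \<omega> (grid t0 h i)) \<longlonglongrightarrow> 0 \<longleftrightarrow> Re lam < 0"
proof
  assume lim: "(\<lambda>i. \<omega> (grid t0 h i)) \<longlonglongrightarrow> 0"
  show "Re lam < 0"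
  proof (rule ccontr)
    assume "\<not> Re lam < 0"
    with lam have "Re lam = 0" by simp
    then have "(\<lambda>i::nat. cmod y0) \<longlonglongrightarrow> 0"
      using tendsto_norm_zero[OF lim] by (simp only: grid_values_norm_constant[OF w h])
    then show False
      using y0 by (simp add: LIMSEQ_const_iff)
  qed
next
  assume "Re lam < 0"
  then obtain R where "cmod R < 1" and R: "\<And>i. \<omega> (grid t0 h i) = R ^ i * y0"
    using grid_values_geometric[OF P r _ h w y0] by blast
  then have "(\<lambda>i. R ^ i * y0) \<longlonglongrightarrow> 0"
    by (intro tendsto_mult_left_zero LIMSEQ_power_zero)
  then show "(\<lambda>i. \<omega> (grid t0 h i)) \<longlonglongrightarrow> 0"
    by (simp add: R)
qed

section \<open>The exact solution\<close>

text \<open>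
  The equation makes \<open>y t * exp (-\<lambda> * (t - t\<^sub>0))\<close> constant on the half-line.
\<close>
lemma linear_ode_solution:
  fixes y :: "real \<Rightarrow> complex"
  assumes y: "\<And>t. t \<ge> t0 \<Longrightarrow> (y has_vector_derivative lam * y t) (at t within {t0..})"
    and t: "t \<ge> t0"
  shows "y t = y t0 * exp (lam * of_real (t - t0))"
proof -
  define z where "z s = y s * exp (- lam * of_real (s - t0))" for s
  have "(z has_vector_derivative 0) (at s within {t0..})" if "s \<in> {t0..}" for s
  proof -
    have "((\<lambda>w. exp (- lam * (w - of_real t0))) has_field_derivative
        - lam * exp (- lam * (of_real s - of_real t0))) (at (of_real s))"
      by (auto intro!: derivative_eq_intros)
    then have e: "((\<lambda>s. exp (- lam * of_real (s - t0))) has_vector_derivative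
        - lam * exp (- lam * of_real (s - t0))) (at s within {t0..})"
      using has_vector_derivative_real_field[of _ _ s "{t0..}"] by (simp add: o_def)
    have "(z has_vector_derivative
        y s * (- lam * exp (- lam * of_real (s - t0)))
        + lam * y s * exp (- lam * of_real (s - t0))) (at s within {t0..})"
      unfolding z_def using that by (intro has_vector_derivative_mult e y) simp
    then show ?thesis by (simp add: algebra_simps)
  qed
  then obtain k where k: "\<And>s. s \<in> {t0..} \<Longrightarrow> z s = k"
    by (metis has_vector_derivative_zero_constant convex_real_interval(1))
  then have "z t = z t0" using t by simp
  then have "y t * exp (- (lam * of_real (t - t0))) = y t0"
    by (simp add: z_def)
  moreover have "exp (- (lam * of_real (t - t0))) * exp (lam * of_real (t - t0)) = 1"
    by (simp only: mult.commute[of "exp (- _)"] exp_minus_inverse)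
  ultimately show ?thesis
    by (metis mult.assoc mult.right_neutral)
qed

lemma linear_ode_solution_norm:
  fixes y :: "real \<Rightarrow> complex"
  assumes "\<And>t. t \<ge> t0 \<Longrightarrow> (y has_vector_derivative lam * y t) (at t within {t0..})"
    and "t \<ge> t0"
  shows "cmod (y t) = cmod (y t0) * exp (Re lam * (t - t0))"
  using linear_ode_solution[OF assms] by (simp add: norm_mult)

lemma linear_ode_solution_tendsto_0_iff:
  fixes y :: "real \<Rightarrow> complex"
  assumes y: "\<And>t. t \<ge> t0 \<Longrightarrow> (y has_vector_derivative lam * y t) (at t within {t0..})"
    and y0: "y t0 \<noteq> 0"
  shows "(y \<longlongrightarrow> 0) at_top \<longleftrightarrow> Re lam < 0"
proof -
  have ev: "\<forall>\<^sub>F t in at_top. cmod (y t) = cmod (y t0) * exp (Re lam * (t - t0))"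
    using eventually_ge_at_top[of t0] by eventually_elim (rule linear_ode_solution_norm[OF y])
  show ?thesis
  proof
    assume lim: "(y \<longlongrightarrow> 0) at_top"
    show "Re lam < 0"
    proof (rule ccontr)
      assume neg: "\<not> Re lam < 0"
      have "\<forall>\<^sub>F t in at_top. cmod (y t0) \<le> cmod (y t)"
        using ev eventually_ge_at_top[of t0]
      proof eventually_elim
        case (elim t)
        with neg have "1 \<le> exp (Re lam * (t - t0))" by simp
        then show ?case
          unfolding elim(1) by (intro mult_le_cancel_left1[THEN iffD2]) auto
      qed
      then have "cmod (y t0) \<le> 0"
        by (intro tendsto_lowerbound[OF tendsto_norm_zero[OF lim]]) simp_all
      with y0 show False by simp
    qed
  next
    assume neg: "Re lam < 0"
    have "filterlim (\<lambda>t. t - t0) at_top at_top"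
      using filterlim_tendsto_add_at_top[OF tendsto_const[of "- t0"] filterlim_ident] by simp
    then have "filterlim (\<lambda>t. Re lam * (t - t0)) at_bot at_top"
      by (rule filterlim_tendsto_neg_mult_at_bot[OF tendsto_const neg])
    then have "((\<lambda>t. cmod (y t0) * exp (Re lam * (t - t0))) \<longlongrightarrow> 0) at_top"
      by (intro tendsto_mult_right_zero filterlim_compose[OF exp_at_bot])
    then have "((\<lambda>t. cmod (y t)) \<longlongrightarrow> 0) at_top"
      by (rule tendsto_cong[OF ev, THEN iffD2])
    then show "(y \<longlongrightarrow> 0) at_top"
      by (rule tendsto_norm_zero_cancel)
  qed
qed

section \<open>Equality of the stability properties\<close>

theorem theorem2p3:
  fixes P :: "nat \<Rightarrow> real poly" and r :: nat and lam y0 :: complex and t0 h :: real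
    and y \<omega> :: "real \<Rightarrow> complex"
  assumes "orthonormal_shifted_Legendre P"
    and "r \<ge> 1"
    and "Re lam \<le> 0"
    and "y0 \<noteq> 0"
    and "y t0 = y0"
    and "\<And>t. t \<ge> t0 \<Longrightarrow> (y has_vector_derivative lam * y t) (at t within {t0..})"
    and "h > 0"
    and "piecewise_poly_approx P r lam t0 y0 h \<omega>"
  shows "((\<lambda>i. \<omega> (grid t0 h i)) \<longlonglongrightarrow> 0 \<longleftrightarrow> Re lam < 0)
    \<and> ((\<lambda>i. \<omega> (grid t0 h i)) \<longlonglongrightarrow> 0 \<longleftrightarrow> (y \<longlongrightarrow> 0) at_top)
    \<and> (Re lam = 0 \<longrightarrow> bounded (range (\<lambda>i. \<omega> (grid t0 h i))) \<and> bounded (y ` {t0..}))"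
proof (intro conjI impI)
  show discrete: "(\<lambda>i. \<omega> (grid t0 h i)) \<longlonglongrightarrow> 0 \<longleftrightarrow> Re lam < 0"
    by (rule grid_values_tendsto_0_iff) fact+
  have "(y \<longlongrightarrow> 0) at_top \<longleftrightarrow> Re lam < 0"
    using assms(4,5) by (intro linear_ode_solution_tendsto_0_iff[OF assms(6)]) simp_all
  with discrete show "(\<lambda>i. \<omega> (grid t0 h i)) \<longlonglongrightarrow> 0 \<longleftrightarrow> (y \<longlongrightarrow> 0) at_top"
    by simp
  assume lam: "Re lam = 0"
  show "bounded (range (\<lambda>i. \<omega> (grid t0 h i)))"
    unfolding bounded_iff
    using grid_values_norm_constant[OF assms(8,7) lam] by (intro exI[of _ "cmod y0"]) simp
  show "bounded (y ` {t0..})"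
    unfolding bounded_iff
    using linear_ode_solution_norm[OF assms(6)] lam assms(5)
    by (intro exI[of _ "cmod y0"]) simp
qed

end
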